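(* Let $T$ be a finite tree, $xy\in E(T)$ an edge, and let $T^{(2)}$ be the tree obtained from $T$ by inserting one new vertex of degree $2$ into the edge $xy$. Put $\lambda_1=\lambda_{\max}(R_T)$ and $\lambda_2=\lambda_{\max}(R_{T^{(2)}})$. If $d_x\ge 3$, $d_y\ge 3$, and $$\lambda_1>\max\left\{\frac{2}{d_x(d_x-2)},\ \frac{2}{d_y(d_y-2)}\right\},$$ then $\lambda_2<\lambda_1$.
   Context: For a finite tree $T=(V,E)$ let $d_z$ denote the degree of the vertex $z$. The Ricci matrix $R_T\in\mathbb R^{E\times E}$ is the real symmetric matrix indexed by edges with entries $(R_T)_{e,e}=-\left(\frac1{d_x}+\frac1{d_y}\right)$ for $e=\{x,y\}$, $(R_T)_{e,e'}=\frac1{d_z}$ if $e\ne e'$ and $e\cap e'=\{z\}$, and $(R_T)_{e,e'}=0$ if $e\cap e'=\varnothing$. $\lambda_{\max}(M)$ denotes the largest eigenvalue of a real symmetric matrix $M$. In $T^{(2)}$ the edge $xy$ is replaced by two edges $xv_1$ and $v_1y$, where $v_1$ is a new vertex of degree $2$; everything else is unchanged. The degrees $d_x,d_y$ are the same in $T$ and $T^{(2)}$. *)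

theory Defs
  imports Complex_Main "Graph_Theory.Graph_Theory"
begin

text \<open>
  A finite simple graph is a \<^locale>\<open>pair_graph\<close>: a finite loop-free digraph in which every
  undirected edge is represented by its two opposite arcs.  The constant
  \<^const>\<open>Digraph_Component.tree\<close> is about directed cycles, and a pair of opposite arcs is a
  directed cycle; here a tree is a nonempty connected graph without cycles of length at least 3,
  which are the cycles in the undirected sense.
\<close>

definition finite_tree :: "'a pair_pre_digraph \<Rightarrow> bool" where
  "finite_tree G \<longleftrightarrow> pair_graph G \<and> Digraph_Component.connected (with_proj G) \<and>
     \<not> (\<exists>p. pre_digraph.cycle (with_proj G) p \<and> 3 \<le> length p)"

definition uedges :: "'a pair_pre_digraph \<Rightarrow> 'a set set" where
  "uedges G = {{u, v} | u v. (u, v) \<in> parcs G}"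

definition vdeg :: "'a pair_pre_digraph \<Rightarrow> 'a \<Rightarrow> nat" where
  "vdeg G z = out_degree (with_proj G) z"

lemma vdeg_eq_card_uedges:
  assumes "pair_graph G"
  shows "vdeg G z = card {e \<in> uedges G. z \<in> e}"
proof -
  interpret pair_graph G by fact
  have sym: "(v, u) \<in> parcs G" if "(u, v) \<in> parcs G" for u v
    using that pair_sym_arcs by (auto simp: symmetric_def dest: symD)
  have "bij_betw (\<lambda>a. {fst a, snd a}) (out_arcs (with_proj G) z) {e \<in> uedges G. z \<in> e}"
    unfolding bij_betw_def
  proof
    show "inj_on (\<lambda>a. {fst a, snd a}) (out_arcs (with_proj G) z)"
      by (auto simp: inj_on_def out_arcs_def doubleton_eq_iff)
    show "(\<lambda>a. {fst a, snd a}) ` out_arcs (with_proj G) z = {e \<in> uedges G. z \<in> e}"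
    proof (intro set_eqI iffI)
      fix e assume "e \<in> {e \<in> uedges G. z \<in> e}"
      then obtain u v where e: "e = {u, v}" "(u, v) \<in> parcs G" "z \<in> e"
        unfolding uedges_def by blast
      then consider "z = u" | "z = v" by blast
      then obtain t where "e = {z, t}" "(z, t) \<in> parcs G"
        using e sym by cases (auto simp: insert_commute)
      then have "(z, t) \<in> out_arcs (with_proj G) z" "e = {fst (z, t), snd (z, t)}"
        by (simp_all add: out_arcs_def)
      then show "e \<in> (\<lambda>a. {fst a, snd a}) ` out_arcs (with_proj G) z"
        by (intro image_eqI)
    next
      fix e assume "e \<in> (\<lambda>a. {fst a, snd a}) ` out_arcs (with_proj G) z"
      then obtain t where "e = {z, t}" "(z, t) \<in> parcs G"
        by (auto simp: out_arcs_def)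
      then show "e \<in> {e \<in> uedges G. z \<in> e}"
        unfolding uedges_def by blast
    qed
  qed
  then show ?thesis
    unfolding vdeg_def out_degree_def by (rule bij_betw_same_card)
qed

text \<open>
  Matrices indexed by a finite set \<open>I\<close> are functions of two arguments, of which only the values on
  \<open>I \<times> I\<close> matter; likewise only the values of a vector on \<open>I\<close> matter.
\<close>

definition eigenvalues_on :: "'i set \<Rightarrow> ('i \<Rightarrow> 'i \<Rightarrow> real) \<Rightarrow> real set" where
  "eigenvalues_on I M =
     {k. \<exists>v. (\<exists>i\<in>I. v i \<noteq> 0) \<and> (\<forall>i\<in>I. (\<Sum>j\<in>I. M i j * v j) = k * v i)}"

definition lambda_max :: "'i set \<Rightarrow> ('i \<Rightarrow> 'i \<Rightarrow> real) \<Rightarrow> real" where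
  "lambda_max I M = Max (eigenvalues_on I M)"

definition ricci :: "'a pair_pre_digraph \<Rightarrow> 'a set \<Rightarrow> 'a set \<Rightarrow> real" where
  "ricci G e e' =
     (if e = e' then - (\<Sum>z\<in>e. 1 / real (vdeg G z))
      else if e \<inter> e' = {} then 0
      else 1 / real (vdeg G (the_elem (e \<inter> e'))))"

lemma ricci_diag: "x \<noteq> y \<Longrightarrow> ricci G {x, y} {x, y} = - (1 / real (vdeg G x) + 1 / real (vdeg G y))"
  by (simp add: ricci_def)

lemma ricci_adjacent: "e \<noteq> e' \<Longrightarrow> e \<inter> e' = {z} \<Longrightarrow> ricci G e e' = 1 / real (vdeg G z)"
  by (simp add: ricci_def)

lemma ricci_disjoint: "e \<noteq> e' \<Longrightarrow> e \<inter> e' = {} \<Longrightarrow> ricci G e e' = 0"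
  by (simp add: ricci_def)

definition ricci_lambda_max :: "'a pair_pre_digraph \<Rightarrow> real" where
  "ricci_lambda_max G = lambda_max (uedges G) (ricci G)"

end

theory Submission
  imports Defs "HOL-Analysis.Function_Topology"
begin

text \<open>
  Suppose \<open>\<lambda>\<^sub>2 \<ge> \<lambda>\<^sub>1\<close> and let \<open>g \<ge> 0\<close> be a top eigenvector on the subdivided tree, with values \<open>a\<close> and
  \<open>b\<close> on the two halves of \<open>xy\<close>.  Keep \<open>g\<close> on all other edges of \<open>T\<close> and give \<open>xy\<close> the value \<open>t\<close>.
  The eigenvalue equations at the two halves turn the change of the Rayleigh form (minus \<open>\<lambda>\<^sub>2\<close> times
  the square norm) into a quadratic polynomial in \<open>t\<close>, whose maximum is a quadratic form in
  \<open>(a, b)\<close>.  The same equations with \<open>g \<ge> 0\<close> confine \<open>(a, b)\<close> to a cone, and the bound on \<open>\<lambda>\<^sub>1\<close> is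
  exactly what makes that form positive on both rays of the cone.  Hence \<open>\<lambda>\<^sub>1 > \<lambda>\<^sub>2\<close>, a contradiction;
  \<open>a = b = 0\<close> is excluded because \<open>g\<close> would vanish everywhere by connectedness.
\<close>

section \<open>The largest eigenvalue of a symmetric matrix\<close>

definition quad_form :: "'i set \<Rightarrow> ('i \<Rightarrow> 'i \<Rightarrow> real) \<Rightarrow> ('i \<Rightarrow> real) \<Rightarrow> real" where
  "quad_form I M v = (\<Sum>i\<in>I. v i * (\<Sum>j\<in>I. M i j * v j))"

definition sq_norm :: "'i set \<Rightarrow> ('i \<Rightarrow> real) \<Rightarrow> real" where
  "sq_norm I v = (\<Sum>i\<in>I. (v i)\<^sup>2)"

lemma sq_norm_pos:
  assumes "finite I" "i \<in> I" "v i \<noteq> 0"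
  shows "sq_norm I v > 0"
  unfolding sq_norm_def using assms by (intro sum_pos2[of I i]) auto

lemma quad_form_scale: "quad_form I M (\<lambda>i. c * v i) = c\<^sup>2 * quad_form I M v"
  by (simp add: quad_form_def sum_distrib_left power2_eq_square mult_ac)

lemma sq_norm_scale: "sq_norm I (\<lambda>i. c * v i) = c\<^sup>2 * sq_norm I v"
  by (simp add: sq_norm_def sum_distrib_left power_mult_distrib)

lemma quad_form_eigenvector:
  assumes "\<forall>i\<in>I. (\<Sum>j\<in>I. M i j * v j) = k * v i"
  shows "quad_form I M v = k * sq_norm I v"
  using assms by (simp add: quad_form_def sq_norm_def sum_distrib_left power2_eq_square mult_ac)

text \<open>Moves along one coordinate are enough for what follows: each yields the eigenvalue
  equation of one row. Symmetry merges the two cross terms into the factor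
  \<open>2 * t\<close>.\<close>

lemma quad_form_add_unit:
  assumes "finite I" "i \<in> I" and sym: "\<And>i j. i \<in> I \<Longrightarrow> j \<in> I \<Longrightarrow> M i j = M j i"
  shows "quad_form I M (\<lambda>j. v j + (if j = i then t else 0)) =
    quad_form I M v + 2 * t * (\<Sum>j\<in>I. M i j * v j) + t\<^sup>2 * M i i"
proof -
  have row: "(\<Sum>j\<in>I. M l j * (v j + (if j = i then t else 0))) = (\<Sum>j\<in>I. M l j * v j) + t * M l i" for l
    using assms by (simp add: distrib_left sum.distrib if_distrib[of "\<lambda>x. _ * x"] cong: if_cong)
  have "quad_form I M (\<lambda>j. v j + (if j = i then t else 0)) =
    (\<Sum>l\<in>I. v l * (\<Sum>j\<in>I. M l j * v j) + t * (M l i * v l)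
      + (if l = i then t * (\<Sum>j\<in>I. M i j * v j) + t\<^sup>2 * M i i else 0))"
    unfolding quad_form_def row
    by (intro sum.cong refl) (auto simp: distrib_left distrib_right power2_eq_square mult_ac)
  also have "\<dots> = quad_form I M v + t * (\<Sum>l\<in>I. M l i * v l)
      + (t * (\<Sum>j\<in>I. M i j * v j) + t\<^sup>2 * M i i)"
    using assms(1,2) by (simp add: sum.distrib quad_form_def flip: sum_distrib_left)
  also have "(\<Sum>l\<in>I. M l i * v l) = (\<Sum>j\<in>I. M i j * v j)"
    using sym assms(2) by (intro sum.cong) auto
  finally show ?thesis
    by simp
qed

lemma sq_norm_add_unit:
  assumes "finite I" "i \<in> I"
  shows "sq_norm I (\<lambda>j. v j + (if j = i then t else 0)) = sq_norm I v + 2 * t * v i + t\<^sup>2"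
proof -
  have "(v j + (if j = i then t else 0))\<^sup>2 = (v j)\<^sup>2 + (if j = i then 2 * t * v i + t\<^sup>2 else 0)" for j
    by (simp add: power2_sum)
  then show ?thesis
    using assms by (simp add: sq_norm_def sum.distrib)
qed

lemma linear_coeff_zero:
  fixes r c :: real
  assumes "\<And>t. 2 * t * r + t\<^sup>2 * c \<le> 0"
  shows "r = 0"
proof (rule ccontr)
  assume "r \<noteq> 0"
  \<comment> \<open>The test value \<open>r / C\<close> has the sign of \<open>r\<close>, and since
    \<open>2 * C + c > 0\<close> the linear term wins over the quadratic one; the \<open>+ 1\<close>
    covers \<open>c = 0\<close>.\<close>
  define C where "C = \<bar>c\<bar> + 1"
  have C: "C > 0" "2 * C + c > 0" by (auto simp: C_def)
  have "2 * (r / C) * r + (r / C)\<^sup>2 * c = (r / C)\<^sup>2 * (2 * C + c)"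
    using C by (simp add: field_simps power2_eq_square)
  also have "\<dots> > 0"
    using C \<open>r \<noteq> 0\<close> by (intro mult_pos_pos) auto
  finally show False
    using assms[of "r / C"] by simp
qed

text \<open>The form minus \<open>k\<close> times the square norm is nowhere positive and vanishes
  at \<open>v\<close>, so its derivative in coordinate \<open>i\<close> is 0; that derivative is
  twice the residual of row \<open>i\<close>.\<close>

lemma rayleigh_maximizer_eigenvector:
  assumes "finite I" and sym: "\<And>i j. i \<in> I \<Longrightarrow> j \<in> I \<Longrightarrow> M i j = M j i"
    and bound: "\<And>w. quad_form I M w \<le> k * sq_norm I w"
    and max: "quad_form I M v \<ge> k * sq_norm I v"
    and i: "i \<in> I"
  shows "(\<Sum>j\<in>I. M i j * v j) = k * v i"
proof -
  have "2 * t * ((\<Sum>j\<in>I. M i j * v j) - k * v i) + t\<^sup>2 * (M i i - k) \<le> 0" for t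
    using bound[of "\<lambda>j. v j + (if j = i then t else 0)"] max
      quad_form_add_unit[of I i M v t, OF assms(1) i sym] sq_norm_add_unit[OF assms(1) i, of v t]
    by (simp add: algebra_simps)
  then show ?thesis
    using linear_coeff_zero by fastforce
qed

text \<open>A continuous form attains its maximum on the compact unit sphere; homogeneity of degree
  2 carries the bound to all vectors.\<close>

lemma exists_rayleigh_maximizer:
  fixes M :: "'i \<Rightarrow> 'i \<Rightarrow> real"
  assumes "finite I" "I \<noteq> {}"
  obtains v k where "\<exists>i\<in>I. v i \<noteq> 0" "quad_form I M v = k * sq_norm I v"
    "\<And>w. quad_form I M w \<le> k * sq_norm I w"
proof -
  \<comment> \<open>Pinning the coordinates outside \<open>I\<close> to 0 makes the box a product of
    compact sets, hence compact by Tychonoff even over an infinite index type.\<close>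
  define B :: "('i \<Rightarrow> real) set" where "B = PiE UNIV (\<lambda>i. if i \<in> I then {-1..1} else {0})"
  define S where "S = {v. sq_norm I v = 1} \<inter> B"
  have "compact B"
    using compactin_PiE[of "\<lambda>_::'i. euclidean :: real topology" UNIV "\<lambda>i. if i \<in> I then {-1..1} else {0}"]
    by (auto simp: B_def euclidean_product_topology compactin_euclidean_iff)
  moreover have "continuous_on UNIV (sq_norm I)"
    unfolding sq_norm_def[abs_def] by (intro continuous_intros continuous_on_product_coordinates)
  then have "closed {v. sq_norm I v = 1}"
    by (intro closed_Collect_eq) auto
  ultimately have "compact S"
    unfolding S_def by (rule closed_Int_compact[rotated])
  have normalize: "\<exists>u\<in>S. \<exists>c. c \<noteq> 0 \<and> (\<forall>i\<in>I. w i = c * u i)" if nz: "sq_norm I w \<noteq> 0" for w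
  proof -
    define c where "c = sqrt (sq_norm I w)"
    have c2: "c\<^sup>2 = sq_norm I w" "c > 0"
      using nz by (auto simp: c_def sq_norm_def sum_nonneg less_le)
    define u where "u i = (if i \<in> I then w i / c else 0)" for i
    have "sq_norm I u = (\<Sum>i\<in>I. (w i)\<^sup>2) / c\<^sup>2"
      unfolding sq_norm_def u_def by (simp add: power_divide sum_divide_distrib)
    then have u1: "sq_norm I u = 1"
      using c2 nz by (simp add: sq_norm_def)
    have "\<bar>u i\<bar> \<le> 1" if "i \<in> I" for i
    proof -
      have "(u i)\<^sup>2 \<le> sq_norm I u"
        unfolding sq_norm_def using assms(1) that by (intro member_le_sum) auto
      then show ?thesis using u1 by (simp add: abs_square_le_1)
    qed
    then have "u \<in> B"
      unfolding B_def PiE_UNIV_domain Pi_def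
      by (smt (verit) UNIV_I atLeastAtMost_iff mem_Collect_eq singleton_iff u_def)
    then show ?thesis
      using u1 c2 by (intro bexI[of _ u] exI[of _ c]) (auto simp: S_def u_def)
  qed
  obtain i where "i \<in> I" using assms(2) by blast
  then have "sq_norm I (\<lambda>_. 1) > 0"
    by (intro sq_norm_pos[OF assms(1)]) auto
  then have "S \<noteq> {}"
    using normalize[of "\<lambda>_. 1"] by auto
  moreover have "continuous_on S (quad_form I M)"
    unfolding quad_form_def[abs_def]
    by (intro continuous_intros continuous_on_subset[OF continuous_on_product_coordinates]) auto
  ultimately obtain v where v: "v \<in> S" "\<And>u. u \<in> S \<Longrightarrow> quad_form I M u \<le> quad_form I M v"
    using continuous_attains_sup[OF \<open>compact S\<close>] by metis
  have v1: "sq_norm I v = 1" using v(1) by (simp add: S_def)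
  have "quad_form I M w \<le> quad_form I M v * sq_norm I w" for w
  proof (cases "sq_norm I w = 0")
    case True
    then have "\<forall>i\<in>I. w i = 0"
      using sq_norm_pos[OF assms(1), of _ w] by fastforce
    then show ?thesis by (simp add: True quad_form_def)
  next
    case False
    then obtain u c where u: "u \<in> S" "\<forall>i\<in>I. w i = c * u i" using normalize by blast
    have "quad_form I M w = quad_form I M (\<lambda>i. c * u i)" "sq_norm I w = sq_norm I (\<lambda>i. c * u i)"
      using u(2) by (simp_all add: quad_form_def sq_norm_def)
    then show ?thesis
      using u(1) mult_left_mono[OF v(2)[OF u(1)], of "c\<^sup>2"]
      by (simp add: quad_form_scale sq_norm_scale S_def mult.commute)
  qed
  moreover have "\<exists>i\<in>I. v i \<noteq> 0"
    using v1 by (auto simp: sq_norm_def intro: ccontr)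
  ultimately show thesis
    using that[of v "quad_form I M v"] v1 by simp
qed

text \<open>Bessel's inequality for the unit vectors bounds the size of an orthonormal family.\<close>

lemma card_orthonormal_le:
  fixes u :: "'k \<Rightarrow> 'i \<Rightarrow> real"
  assumes "finite I" "finite K"
    and orth: "\<And>k l. k \<in> K \<Longrightarrow> l \<in> K \<Longrightarrow> (\<Sum>i\<in>I. u k i * u l i) = (if k = l then 1 else 0)"
  shows "card K \<le> card I"
proof -
  have bessel: "(\<Sum>k\<in>K. (u k i)\<^sup>2) \<le> 1" if "i \<in> I" for i
  proof -
    \<comment> \<open>\<open>s\<close> is the orthogonal projection of the unit vector at
      \<open>i\<close> onto the span of the family. Idempotence gives \<open>ss\<close>, and the
      squared distance from the unit vector to \<open>s\<close> is then
      \<open>1 - s i\<close>.\<close>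
    define s where "s j = (\<Sum>k\<in>K. u k i * u k j)" for j
    have ss: "(\<Sum>j\<in>I. s j * s j) = s i"
    proof -
      have "(\<Sum>j\<in>I. s j * s j) = (\<Sum>j\<in>I. \<Sum>k\<in>K. \<Sum>l\<in>K. u k i * u l i * (u k j * u l j))"
        by (simp add: s_def sum_product mult_ac)
      also have "\<dots> = (\<Sum>k\<in>K. \<Sum>l\<in>K. \<Sum>j\<in>I. u k i * u l i * (u k j * u l j))"
        by (subst sum.swap, rule sum.cong[OF refl], rule sum.swap)
      also have "\<dots> = (\<Sum>k\<in>K. \<Sum>l\<in>K. u k i * u l i * (if k = l then 1 else 0))"
        by (intro sum.cong refl) (simp add: orth flip: sum_distrib_left)
      also have "\<dots> = s i"
        using assms(2) by (simp add: s_def if_distrib[of "\<lambda>x. _ * x"] cong: if_cong)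
      finally show ?thesis .
    qed
    have "0 \<le> (\<Sum>j\<in>I. ((if j = i then 1 else 0) - s j)\<^sup>2)"
      by (intro sum_nonneg) auto
    also have "\<dots> = (\<Sum>j\<in>I. (if j = i then 1 - 2 * s j else 0) + s j * s j)"
      by (intro sum.cong refl) (auto simp: power2_eq_square algebra_simps)
    also have "\<dots> = 1 - s i"
      using ss assms(1) that by (simp add: sum.distrib)
    finally show ?thesis
      by (simp add: s_def power2_eq_square)
  qed
  have "real (card K) = (\<Sum>k\<in>K. \<Sum>i\<in>I. (u k i)\<^sup>2)"
    using orth by (simp add: power2_eq_square)
  also have "\<dots> = (\<Sum>i\<in>I. \<Sum>k\<in>K. (u k i)\<^sup>2)"
    by (rule sum.swap)
  also have "\<dots> \<le> (\<Sum>i\<in>I. 1)"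
    by (intro sum_mono bessel)
  finally show ?thesis by simp
qed

text \<open>This gives \<open>Max\<close> in \<open>lambda_max\<close> its meaning. Eigenvectors of
  distinct eigenvalues are orthogonal, so there are at most \<open>card I\<close> of them.\<close>

lemma finite_eigenvalues_on:
  assumes "finite I" and sym: "\<And>i j. i \<in> I \<Longrightarrow> j \<in> I \<Longrightarrow> M i j = M j i"
  shows "finite (eigenvalues_on I M)"
proof (rule ccontr)
  assume "infinite (eigenvalues_on I M)"
  then obtain K where K: "K \<subseteq> eigenvalues_on I M" "finite K" "card K = Suc (card I)"
    using infinite_arbitrarily_large by blast
  have "\<forall>k\<in>K. \<exists>v. (\<exists>i\<in>I. v i \<noteq> 0) \<and> (\<forall>i\<in>I. (\<Sum>j\<in>I. M i j * v j) = k * v i)"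
    using K(1) by (auto simp: eigenvalues_on_def)
  then obtain v where v: "\<And>k. k \<in> K \<Longrightarrow> \<exists>i\<in>I. v k i \<noteq> 0"
    "\<And>k i. k \<in> K \<Longrightarrow> i \<in> I \<Longrightarrow> (\<Sum>j\<in>I. M i j * v k j) = k * v k i"
    by metis
  have orth: "(\<Sum>i\<in>I. v k i * v l i) = 0" if "k \<in> K" "l \<in> K" "k \<noteq> l" for k l
  proof -
    \<comment> \<open>By symmetry the matrix may act on either factor, so the inner product is
      scaled by \<open>l\<close> and by \<open>k\<close> alike.\<close>
    have "l * (\<Sum>i\<in>I. v k i * v l i) = (\<Sum>i\<in>I. v k i * (\<Sum>j\<in>I. M i j * v l j))"
      using v(2)[OF that(2)] by (simp add: sum_distrib_left mult_ac)
    also have "\<dots> = (\<Sum>i\<in>I. \<Sum>j\<in>I. M j i * v k i * v l j)"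
      using sym by (simp add: sum_distrib_left mult_ac)
    also have "\<dots> = (\<Sum>j\<in>I. (\<Sum>i\<in>I. M j i * v k i) * v l j)"
      by (subst sum.swap) (simp add: sum_distrib_right)
    also have "\<dots> = k * (\<Sum>i\<in>I. v k i * v l i)"
      using v(2)[OF that(1)] by (simp add: sum_distrib_left mult_ac)
    finally show ?thesis using that(3) by simp
  qed
  define u where "u k i = v k i / sqrt (sq_norm I (v k))" for k i
  have "card K \<le> card I"
  proof (rule card_orthonormal_le[OF assms(1) K(2)])
    fix k l assume kl: "k \<in> K" "l \<in> K"
    have *: "(\<Sum>i\<in>I. u k i * u l i) =
      (\<Sum>i\<in>I. v k i * v l i) / (sqrt (sq_norm I (v k)) * sqrt (sq_norm I (v l)))"
      by (simp add: u_def sum_divide_distrib)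
    show "(\<Sum>i\<in>I. u k i * u l i) = (if k = l then 1 else 0)"
    proof (cases "k = l")
      case True
      have "sq_norm I (v k) > 0"
        using v(1)[OF kl(1)] sq_norm_pos[OF assms(1)] by blast
      then show ?thesis
        unfolding * using True by (simp add: sq_norm_def power2_eq_square)
    qed (simp add: * orth[OF kl])
  qed
  then show False using K(3) by simp
qed

text \<open>The maximal Rayleigh quotient is an eigenvalue, and every eigenvalue is the Rayleigh
  quotient of its own eigenvector.\<close>

lemma lambda_max_rayleigh:
  assumes "finite I" "I \<noteq> {}" and sym: "\<And>i j. i \<in> I \<Longrightarrow> j \<in> I \<Longrightarrow> M i j = M j i"
  shows lambda_max_eigenvalue: "lambda_max I M \<in> eigenvalues_on I M"
    and quad_form_le_lambda_max: "quad_form I M w \<le> lambda_max I M * sq_norm I w"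
proof -
  obtain v k where v: "\<exists>i\<in>I. v i \<noteq> 0" "quad_form I M v = k * sq_norm I v"
    and k: "\<And>w. quad_form I M w \<le> k * sq_norm I w"
    using exists_rayleigh_maximizer[OF assms(1,2)] by blast
  have "k \<in> eigenvalues_on I M"
    unfolding eigenvalues_on_def
    using v rayleigh_maximizer_eigenvector[OF assms(1) sym k, of v] by auto
  moreover have "l \<le> k" if "l \<in> eigenvalues_on I M" for l
  proof -
    from that obtain w i where w: "i \<in> I" "w i \<noteq> 0" "\<forall>i\<in>I. (\<Sum>j\<in>I. M i j * w j) = l * w i"
      by (auto simp: eigenvalues_on_def)
    have "l * sq_norm I w \<le> k * sq_norm I w"
      using k[of w] quad_form_eigenvector[OF w(3)] by simp
    then show ?thesis
      using sq_norm_pos[of I i w] w assms(1) by simp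
  qed
  ultimately have "lambda_max I M = k"
    unfolding lambda_max_def using finite_eigenvalues_on[of I M, OF assms(1) sym]
    by (intro Max_eqI) auto
  then show "lambda_max I M \<in> eigenvalues_on I M" "quad_form I M w \<le> lambda_max I M * sq_norm I w"
    using \<open>k \<in> _\<close> k by auto
qed

text \<open>A Perron-Frobenius argument: absolute values keep the norm and the diagonal terms and
  cannot decrease the off-diagonal ones, so they turn one maximizer into another.\<close>

lemma lambda_max_nonneg_eigenvector:
  assumes "finite I" "I \<noteq> {}" and sym: "\<And>i j. i \<in> I \<Longrightarrow> j \<in> I \<Longrightarrow> M i j = M j i"
    and off_diag: "\<And>i j. i \<in> I \<Longrightarrow> j \<in> I \<Longrightarrow> i \<noteq> j \<Longrightarrow> M i j \<ge> 0"
  obtains v where "\<And>i. v i \<ge> 0" "\<exists>i\<in>I. v i \<noteq> 0"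
    "\<And>i. i \<in> I \<Longrightarrow> (\<Sum>j\<in>I. M i j * v j) = lambda_max I M * v i"
proof -
  obtain v where v: "\<exists>i\<in>I. v i \<noteq> 0" "\<forall>i\<in>I. (\<Sum>j\<in>I. M i j * v j) = lambda_max I M * v i"
    using lambda_max_eigenvalue[of I M, OF assms(1,2) sym] by (auto simp: eigenvalues_on_def)
  let ?w = "\<lambda>i. \<bar>v i\<bar>"
  have "lambda_max I M * sq_norm I ?w = quad_form I M v"
    by (simp add: quad_form_eigenvector[OF v(2)] sq_norm_def)
  also have "\<dots> \<le> quad_form I M ?w"
  proof -
    have "v i * (M i j * v j) \<le> \<bar>v i\<bar> * (M i j * \<bar>v j\<bar>)" if "i \<in> I" "j \<in> I" for i j
    proof (cases "i = j")
      case True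
      have "\<bar>v j\<bar> * \<bar>v j\<bar> = v j * v j" by simp
      then show ?thesis
        unfolding True by (metis mult.left_commute order_refl)
    next
      case False
      have "M i j * (v i * v j) \<le> M i j * (\<bar>v i\<bar> * \<bar>v j\<bar>)"
        by (intro mult_left_mono off_diag that False) (metis abs_ge_self abs_mult)
      then show ?thesis by (simp add: mult_ac)
    qed
    then show ?thesis
      unfolding quad_form_def sum_distrib_left by (intro sum_mono)
  qed
  finally have "(\<Sum>j\<in>I. M i j * ?w j) = lambda_max I M * ?w i" if "i \<in> I" for i
    using rayleigh_maximizer_eigenvector[OF assms(1) sym
        quad_form_le_lambda_max[of I M, OF assms(1,2) sym] _ that, of ?w] by simp
  then show thesis
    using that[of ?w] v(1) by simp
qed

section \<open>Ricci matrices of graphs and their subdivisions\<close>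

lemma uedgesE:
  assumes "pair_graph G" "e \<in> uedges G"
  obtains u w where "e = {u, w}" "u \<noteq> w" "(u, w) \<in> parcs G" "(w, u) \<in> parcs G"
    "u \<in> pverts G" "w \<in> pverts G"
proof -
  interpret pair_graph G by fact
  from assms(2) obtain u w where "e = {u, w}" "(u, w) \<in> parcs G"
    by (auto simp: uedges_def)
  then show thesis
    using that[of u w] pair_no_loops[of "(u, w)"] arcs_symmetric in_arcsD1 in_arcsD2 by simp
qed

lemma uedge_in_parcs:
  assumes "pair_graph G" "{u, w} \<in> uedges G"
  shows "(u, w) \<in> parcs G" and "u \<noteq> w"
  by (rule uedgesE[OF assms]; auto simp: doubleton_eq_iff)+

lemma uedge_subset_pverts: "pair_graph G \<Longrightarrow> e \<in> uedges G \<Longrightarrow> e \<subseteq> pverts G"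
  by (erule (1) uedgesE) simp

lemma finite_uedge: "pair_graph G \<Longrightarrow> e \<in> uedges G \<Longrightarrow> finite e"
  by (erule (1) uedgesE) simp

lemma uedges_eq_image: "uedges G = (\<lambda>(u, w). {u, w}) ` parcs G"
  by (auto simp: uedges_def)

lemma finite_uedges:
  assumes "pair_graph G"
  shows "finite (uedges G)"
proof -
  interpret pair_graph G by fact
  show ?thesis using pair_finite_arcs by (simp add: uedges_eq_image)
qed

lemma ricci_sym: "ricci G e e' = ricci G e' e"
  by (simp add: ricci_def Int_commute)

lemma ricci_nonneg: "e \<noteq> e' \<Longrightarrow> ricci G e e' \<ge> 0"
  by (simp add: ricci_def)

text \<open>This is the unsigned vertex-edge incidence matrix applied to \<open>f\<close>.\<close>

definition incident_sum :: "'a pair_pre_digraph \<Rightarrow> ('a set \<Rightarrow> real) \<Rightarrow> 'a \<Rightarrow> real" where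
  "incident_sum G f z = (\<Sum>e\<in>uedges G. if z \<in> e then f e else 0)"

lemma incident_sum_one:
  assumes "pair_graph G"
  shows "incident_sum G (\<lambda>_. 1) z = real (vdeg G z)"
  unfolding incident_sum_def vdeg_eq_card_uedges[OF assms]
  by (simp add: sum.inter_filter[OF finite_uedges[OF assms], symmetric])

lemma incident_sum_upd:
  assumes "pair_graph G" "e \<in> uedges G"
  shows "incident_sum G (f(e := t)) z = incident_sum G f z + (if z \<in> e then t - f e else 0)"
proof -
  have "incident_sum G (f(e := t)) z =
    (\<Sum>e'\<in>uedges G. (if z \<in> e' then f e' else 0) + (if e' = e then if z \<in> e then t - f e else 0 else 0))"
    unfolding incident_sum_def by (intro sum.cong) auto
  then show ?thesis
    using finite_uedges[OF assms(1)] assms(2) by (simp add: sum.distrib incident_sum_def)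
qed

lemma vdeg_pos:
  assumes "pair_graph G" "e \<in> uedges G" "z \<in> e"
  shows "vdeg G z > 0"
  unfolding vdeg_eq_card_uedges[OF assms(1)] using finite_uedges[OF assms(1)] assms(2,3)
  by (auto simp: card_gt_0_iff)

text \<open>Row \<open>e\<close> splits over the two endpoints, since in a simple graph no other
  edge contains both. Each incident sum counts \<open>e\<close> with weight +1 where the diagonal
  asks for -1, hence the correction \<open>2 * f e\<close>.\<close>

lemma ricci_row:
  assumes G: "pair_graph G" and e: "e \<in> uedges G"
  shows "(\<Sum>e'\<in>uedges G. ricci G e e' * f e') = (\<Sum>z\<in>e. (incident_sum G f z - 2 * f e) / real (vdeg G z))"
proof -
  obtain u w where uw: "e = {u, w}" "u \<noteq> w"
    by (rule uedgesE[OF assms])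
  let ?h = "\<lambda>z e'. ((if z \<in> e' then f e' else 0) - (if e' = e then 2 * f e else 0)) / real (vdeg G z)"
  have "ricci G e e' * f e' = ?h u e' + ?h w e'" if "e' \<in> uedges G" for e'
  proof (cases "e' = e")
    case True
    then show ?thesis using uw by (simp add: ricci_diag field_simps)
  next
    case False
    have "\<not> (u \<in> e' \<and> w \<in> e')"
      using uw False by (rule_tac uedgesE[OF G that]) (auto simp: doubleton_eq_iff)
    then consider "e \<inter> e' = {}" "u \<notin> e'" "w \<notin> e'" | "e \<inter> e' = {u}" "u \<in> e'" "w \<notin> e'"
      | "e \<inter> e' = {w}" "u \<notin> e'" "w \<in> e'"
      using uw by auto
    then show ?thesis
      using False by cases (auto simp: ricci_def)
  qed
  then have "(\<Sum>e'\<in>uedges G. ricci G e e' * f e') = (\<Sum>e'\<in>uedges G. ?h u e') + (\<Sum>e'\<in>uedges G. ?h w e')"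
    by (simp add: sum.distrib)
  moreover have "(\<Sum>e'\<in>uedges G. ?h z e') = (incident_sum G f z - 2 * f e) / real (vdeg G z)" for z
    using finite_uedges[OF G] e
    by (simp add: sum_subtractf incident_sum_def flip: sum_divide_distrib)
  ultimately show ?thesis using uw by simp
qed

text \<open>
  Where a nonnegative eigenvector vanishes on an edge, the row of that edge forces it to vanish on
  all adjacent edges; connectedness propagates this to the whole graph.
\<close>

lemma nonneg_ricci_eigenvector_vanishes:
  assumes G: "pair_graph G" and conn: "Digraph_Component.connected (with_proj G)"
    and nonneg: "\<And>e. f e \<ge> 0"
    and eig: "\<And>e. e \<in> uedges G \<Longrightarrow> (\<Sum>e'\<in>uedges G. ricci G e e' * f e') = k * f e"
    and e0: "e\<^sub>0 \<in> uedges G" "f e\<^sub>0 = 0" and e: "e \<in> uedges G"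
  shows "f e = 0"
proof -
  interpret pair_graph G by fact
  have sum_nn: "incident_sum G f z \<ge> 0" for z
    unfolding incident_sum_def using nonneg by (intro sum_nonneg) auto
  have sum_zero: "incident_sum G f z = 0" if "e \<in> uedges G" "f e = 0" "z \<in> e" for e z
  proof -
    have "(\<Sum>z\<in>e. incident_sum G f z / real (vdeg G z)) = 0"
      using ricci_row[OF G that(1), of f] eig[OF that(1)] that(2) by simp
    then have "incident_sum G f z / real (vdeg G z) = 0"
      using finite_uedge[OF G that(1)] that(3) sum_nn by (subst (asm) sum_nonneg_eq_0_iff) auto
    then show ?thesis using vdeg_pos[OF G that(1,3)] by simp
  qed
  have edge_zero: "f e = 0" if "incident_sum G f z = 0" "e \<in> uedges G" "z \<in> e" for e z
  proof -
    have "(if z \<in> e then f e else 0) = 0"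
      using that(1,2) finite_uedges[OF G] nonneg unfolding incident_sum_def
      by (subst (asm) sum_nonneg_eq_0_iff) auto
    then show ?thesis using that(3) by simp
  qed
  obtain u where u: "u \<in> e\<^sub>0" "u \<in> pverts G"
    by (rule uedgesE[OF G e0(1)]) blast
  obtain w where w: "w \<in> e" "w \<in> pverts G"
    by (rule uedgesE[OF G e]) blast
  \<comment> \<open>Connectedness refers to the symmetric closure, which here is the graph itself.
    The induction along a path carries vanishing incident sums from vertex to vertex.\<close>
  have "u \<rightarrow>\<^sup>*\<^bsub>with_proj G\<^esub> w"
    using conn u(2) w(2) reachable_mk_symmetric_eq[OF pair_sym_arcs]
    unfolding connected_def strongly_connected_def by auto
  then have "incident_sum G f w = 0"
  proof (induction rule: reachable_induct)
    case base
    show ?case using sum_zero[OF e0 u(1)] .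
  next
    case (step a b)
    have "{a, b} \<in> uedges G" using step(2) by (auto simp: uedges_def)
    then show ?case
      using edge_zero[OF step(3), of "{a, b}"] sum_zero[of "{a, b}" b] by simp
  qed
  then show ?thesis using edge_zero[OF _ e w(1)] by simp
qed

section \<open>Edges, incident sums and degrees after subdivision\<close>

lemma uedges_subdivide: "uedges (subdivide G (x, y) v) = uedges G - {{x, y}} \<union> {{x, v}, {v, y}}"
proof -
  let ?f = "\<lambda>(u, w). {u, w}"
  have "?f ` (parcs G - {(x, y), (y, x)}) = ?f ` parcs G - {{x, y}}"
  proof (intro set_eqI iffI)
    fix e assume "e \<in> ?f ` (parcs G - {(x, y), (y, x)})"
    then show "e \<in> ?f ` parcs G - {{x, y}}"
      by (fastforce simp: doubleton_eq_iff)
  next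
    fix e assume "e \<in> ?f ` parcs G - {{x, y}}"
    then show "e \<in> ?f ` (parcs G - {(x, y), (y, x)})"
      by (fastforce simp: insert_commute)
  qed
  moreover have "?f ` {(x, v), (v, x), (v, y), (y, v)} = {{x, v}, {v, y}}"
    by (simp add: insert_commute)
  ultimately show ?thesis
    by (simp only: uedges_eq_image arcs_subdivide image_Un)
qed

text \<open>Setting \<open>g\<close> to 0 at \<open>{x, y}\<close> removes the lost edge while the
  sum still runs over the edges of \<open>G\<close>; the value of \<open>g\<close> there is
  arbitrary.\<close>

lemma incident_sum_subdivide:
  assumes G: "pair_graph G" and xy: "{x, y} \<in> uedges G" and v: "v \<notin> pverts G"
  shows "incident_sum (subdivide G (x, y) v) g z = incident_sum G (g({x, y} := 0)) z
     + (if z \<in> {x, v} then g {x, v} else 0) + (if z \<in> {v, y} then g {v, y} else 0)"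
proof -
  let ?h = "\<lambda>e. if z \<in> e then g e else 0"
  have notin: "e \<notin> uedges G" if "v \<in> e" for e
    using uedge_subset_pverts[OF G] that v by blast
  have "{x, v} \<noteq> {v, y}"
    using uedge_in_parcs(2)[OF G xy] by (auto simp: doubleton_eq_iff)
  then have "incident_sum (subdivide G (x, y) v) g z = (\<Sum>e\<in>uedges G - {{x, y}}. ?h e) + ?h {x, v} + ?h {v, y}"
    unfolding incident_sum_def uedges_subdivide
    using finite_uedges[OF G] notin by (subst sum.union_disjoint) auto
  also have "(\<Sum>e\<in>uedges G - {{x, y}}. ?h e) = incident_sum G (g({x, y} := 0)) z"
    unfolding incident_sum_def using finite_uedges[OF G]
    by (intro sum.mono_neutral_cong_left) auto
  finally show ?thesis by simp
qed

lemma vdeg_subdivide: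
  assumes G: "pair_graph G" and xy: "{x, y} \<in> uedges G" and v: "v \<notin> pverts G"
  shows "vdeg (subdivide G (x, y) v) v = 2"
    and "z \<noteq> v \<Longrightarrow> vdeg (subdivide G (x, y) v) z = vdeg G z"
proof -
  note arcs = uedge_in_parcs[OF G xy]
  have "x \<noteq> v" "y \<noteq> v"
    using uedge_subset_pverts[OF G xy] v by auto
  have "incident_sum G (\<lambda>_. 1) v = 0"
    unfolding incident_sum_def using uedge_subset_pverts[OF G] v
    by (intro sum.neutral) auto
  \<comment> \<open>Degrees are incident sums of the constant 1, so the previous lemma counts them:
    \<open>x\<close> and \<open>y\<close> each trade one edge for another.\<close>
  then have deg: "real (vdeg (subdivide G (x, y) v) z) = real (vdeg G z)
     - (if z \<in> {x, y} then 1 else 0) + (if z \<in> {x, v} then 1 else 0) + (if z \<in> {v, y} then 1 else 0)" for z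
    using incident_sum_subdivide[OF assms, of "\<lambda>_. 1" z]
    by (simp add: incident_sum_upd[OF G xy] incident_sum_one[OF G] incident_sum_one[OF pair_graph.pair_graph_subdivide[OF G arcs(1) v]])
  have "real (vdeg G v) = 0"
    using incident_sum_one[OF G, of v] \<open>incident_sum G _ v = 0\<close> by simp
  then show "vdeg (subdivide G (x, y) v) v = 2"
    using deg[of v] \<open>x \<noteq> v\<close> \<open>y \<noteq> v\<close> by simp
  show "vdeg (subdivide G (x, y) v) z = vdeg G z" if "z \<noteq> v"
    using deg[of z] that arcs(2) by (auto split: if_splits)
qed

text \<open>
  With \<open>\<alpha> = \<mu> + p\<close>, \<open>\<beta> = \<mu> + q\<close>, the pair \<open>(a, b)\<close> lies in the cone spanned by
  \<open>(1, 2\<alpha> + 1)\<close> and \<open>(2\<beta> + 1, 1)\<close>, and the quadratic form has positive coefficients in this basis.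
\<close>

lemma gluing_form_pos:
  fixes p q \<mu> a b :: real
  defines "\<alpha> \<equiv> \<mu> + p" and "\<beta> \<equiv> \<mu> + q"
  assumes p: "p > 0" "2 * p * \<alpha> < \<mu>" and q: "q > 0" "2 * q * \<beta> < \<mu>" and "\<mu> > 0"
    and ba: "b \<le> (2 * \<alpha> + 1) * a" and ab: "a \<le> (2 * \<beta> + 1) * b" and nz: "a \<noteq> 0 \<or> b \<noteq> 0"
  shows "2 * \<alpha> * \<beta> * a * b - q * \<alpha> * a\<^sup>2 - p * \<beta> * b\<^sup>2 - (\<mu> + p + q) * (a - b)\<^sup>2 / 2 > 0"
proof -
  \<comment> \<open>Cramer's rule: up to sign \<open>D\<close> is the determinant of the two rays,
    and \<open>m\<close>, \<open>n\<close> are the coordinates of \<open>(a, b)\<close> along them.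
    The cone inequalities say that both numerators are nonnegative.\<close>
  define D where "D = (2 * \<alpha> + 1) * (2 * \<beta> + 1) - 1"
  define m where "m = ((2 * \<beta> + 1) * b - a) / D"
  define n where "n = ((2 * \<alpha> + 1) * a - b) / D"
  have pos: "\<alpha> > 0" "\<beta> > 0"
    using assms by (auto simp: \<alpha>_def \<beta>_def)
  have "D = 4 * \<alpha> * \<beta> + 2 * \<alpha> + 2 * \<beta>"
    by (simp add: D_def algebra_simps)
  then have "D > 0"
    using pos by (simp add: add_pos_pos)
  then have mn: "m \<ge> 0" "n \<ge> 0"
    using ba ab by (auto simp: m_def n_def)
  have a: "a = m + n * (2 * \<beta> + 1)" and b: "b = m * (2 * \<alpha> + 1) + n"
  proof -
    have "D * a = ((2 * \<beta> + 1) * b - a) + ((2 * \<alpha> + 1) * a - b) * (2 * \<beta> + 1)"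
      and "D * b = ((2 * \<beta> + 1) * b - a) * (2 * \<alpha> + 1) + ((2 * \<alpha> + 1) * a - b)"
      by (simp_all add: D_def algebra_simps)
    then show "a = m + n * (2 * \<beta> + 1)" "b = m * (2 * \<alpha> + 1) + n"
      using \<open>D > 0\<close> by (simp_all add: m_def n_def field_simps)
  qed
  \<comment> \<open>\<open>L\<close> is \<open>D / 2\<close>. The form takes the values
    \<open>(\<mu> - 2 * p * \<alpha>) * L\<close> and \<open>(\<mu> - 2 * q * \<beta>) * L\<close>
    on the two rays, and \<open>C\<close> is the coefficient of the mixed term.\<close>
  define L where "L = 2 * \<alpha> * \<beta> + \<alpha> + \<beta>"
  define C where "C = 2 * (\<mu> * (\<alpha> + \<beta>) + \<alpha> * \<beta> * (4 * \<alpha> * \<beta> + 4 * \<mu> + 2 * (\<mu> + p + q)))"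
  have "L > 0" "C > 0"
    using pos p q \<open>\<mu> > 0\<close> by (auto simp: L_def C_def intro!: add_pos_pos mult_pos_pos)
  have "2 * \<alpha> * \<beta> * a * b - q * \<alpha> * a\<^sup>2 - p * \<beta> * b\<^sup>2 - (\<mu> + p + q) * (a - b)\<^sup>2 / 2
      = m\<^sup>2 * ((\<mu> - 2 * p * \<alpha>) * L) + n\<^sup>2 * ((\<mu> - 2 * q * \<beta>) * L) + m * n * C"
  proof -
    have pq: "p = \<alpha> - \<mu>" "q = \<beta> - \<mu>" by (simp_all add: \<alpha>_def \<beta>_def)
    show ?thesis
      unfolding a b L_def C_def pq by (simp add: field_simps power2_eq_square)
  qed
  moreover have "m \<noteq> 0 \<or> n \<noteq> 0"
    using nz a b by auto
  moreover have "m\<^sup>2 * ((\<mu> - 2 * p * \<alpha>) * L) \<ge> 0" "n\<^sup>2 * ((\<mu> - 2 * q * \<beta>) * L) \<ge> 0" "m * n * C \<ge> 0"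
    using mn p q \<open>L > 0\<close> \<open>C > 0\<close> by simp_all
  moreover have "m\<^sup>2 * ((\<mu> - 2 * p * \<alpha>) * L) > 0" if "m \<noteq> 0"
    using that p \<open>L > 0\<close> by simp
  moreover have "n\<^sup>2 * ((\<mu> - 2 * q * \<beta>) * L) > 0" if "n \<noteq> 0"
    using that q \<open>L > 0\<close> by simp
  ultimately show ?thesis by linarith
qed

section \<open>Comparison of the two trees\<close>

theorem corollary1:
  fixes T :: "'a pair_pre_digraph" and x y v\<^sub>1 :: 'a
  assumes "finite_tree T"
    and "{x, y} \<in> uedges T"
    and "v\<^sub>1 \<notin> pverts T"
    and "vdeg T x \<ge> 3" and "vdeg T y \<ge> 3"
    and "ricci_lambda_max T >
           max (2 / (real (vdeg T x) * (real (vdeg T x) - 2)))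
               (2 / (real (vdeg T y) * (real (vdeg T y) - 2)))"
  shows "ricci_lambda_max (subdivide T (x, y) v\<^sub>1) < ricci_lambda_max T"
proof (rule ccontr)
  define v where "v = v\<^sub>1"
  define T2 where "T2 = subdivide T (x, y) v"
  define k where "k = ricci_lambda_max T2"
  assume "\<not> ?thesis"
  then have k_ge: "ricci_lambda_max T \<le> k"
    by (simp add: k_def T2_def v_def)
  have G: "pair_graph T" and conn: "Digraph_Component.connected (with_proj T)"
    using assms(1) by (auto simp: finite_tree_def)
  note xy = assms(2) and v = assms(3)[folded v_def]
  note arcs = uedge_in_parcs[OF G xy]
  have G2: "pair_graph T2"
    unfolding T2_def by (rule pair_graph.pair_graph_subdivide[OF G arcs(1) v])
  have E2: "uedges T2 = uedges T - {{x, y}} \<union> {{x, v}, {v, y}}"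
    unfolding T2_def by (rule uedges_subdivide)
  have vxy: "v \<noteq> x" "v \<noteq> y"
    using uedge_subset_pverts[OF G xy] v by auto
  have v_notin: "v \<notin> e" if "e \<in> uedges T" for e
    using uedge_subset_pverts[OF G that] v by blast
  have deg2: "vdeg T2 v = 2" "\<And>z. z \<noteq> v \<Longrightarrow> vdeg T2 z = vdeg T z"
    unfolding T2_def using vdeg_subdivide[OF G xy v] by auto

  obtain g where g: "\<And>e. g e \<ge> 0" "\<exists>e\<in>uedges T2. g e \<noteq> 0"
    "\<And>e. e \<in> uedges T2 \<Longrightarrow> (\<Sum>e'\<in>uedges T2. ricci T2 e e' * g e') = k * g e"
    using lambda_max_nonneg_eigenvector[of "uedges T2" "ricci T2"] finite_uedges[OF G2]
    by (auto simp: E2 ricci_sym ricci_nonneg k_def ricci_lambda_max_def)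
  define a b p q where "a = g {x, v}" and "b = g {v, y}"
    and "p = 1 / real (vdeg T x)" and "q = 1 / real (vdeg T y)"
  \<comment> \<open>\<open>S z\<close> collects \<open>g\<close> over the edges at \<open>z\<close>
    that both trees share.\<close>
  define S where "S = incident_sum T (g({x, y} := 0))"
  define X Y where "X = p * S x" and "Y = q * S y"
  have S2: "incident_sum T2 g z = S z + (if z \<in> {x, v} then a else 0) + (if z \<in> {v, y} then b else 0)" for z
    unfolding T2_def S_def a_def b_def by (rule incident_sum_subdivide[OF G xy v])
  have S_nonneg: "S z \<ge> 0" for z
    unfolding S_def incident_sum_def using g(1) by (intro sum_nonneg) auto
  have S_v: "S v = 0"
    unfolding S_def incident_sum_def using v_notin by (intro sum.neutral) auto
  have ab_nonneg: "a \<ge> 0" "b \<ge> 0"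
    using g(1) by (auto simp: a_def b_def)
  have p: "p > 0" "2 * p * (k + p) < k" and q: "q > 0" "2 * q * (k + q) < k" and "k > 0"
  proof -
    \<comment> \<open>Clearing denominators turns the eigenvalue bound into the hypothesis of
      \<open>gluing_form_pos\<close>; \<open>d \<ge> 3\<close> keeps \<open>d * (d - 2)\<close>
      positive.\<close>
    have *: "1 / d > 0 \<and> 2 * (1 / d) * (k + 1 / d) < k \<and> k > 0"
      if "d \<ge> 3" "k > 2 / (d * (d - 2))" for d :: real
    proof -
      have d: "d * (d - 2) > 0" using that(1) by simp
      then have "k > 0" using that(2) by (smt (verit) divide_pos_pos)
      moreover have "2 < k * (d * (d - 2))" using that(2) d by (simp add: pos_divide_less_eq)
      then have "2 * (k * d + 1) < k * d\<^sup>2" by (simp add: algebra_simps power2_eq_square)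
      then have "2 * (k * d + 1) / d\<^sup>2 < k" using that(1) by (simp add: pos_divide_less_eq)
      moreover have "2 * (1 / d) * (k + 1 / d) = 2 * (k * d + 1) / d\<^sup>2"
        using that(1) by (simp add: field_simps power2_eq_square)
      ultimately show ?thesis using that(1) by simp
    qed
    have "k > 2 / (real (vdeg T x) * (real (vdeg T x) - 2))"
      "k > 2 / (real (vdeg T y) * (real (vdeg T y) - 2))"
      using assms(6) k_ge by auto
    then show "p > 0" "2 * p * (k + p) < k" "q > 0" "2 * q * (k + q) < k" "k > 0"
      using *[of "real (vdeg T x)"] *[of "real (vdeg T y)"] assms(4,5) by (auto simp: p_def q_def)
  qed

  \<comment> \<open>These are the rows of the two halves solved for the outer contributions; each
    \<open>1 / 2\<close> comes from the degree 2 of \<open>v\<close>.\<close>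
  have X: "X = (k + p + 1 / 2) * a - b / 2" and Y: "Y = (k + q + 1 / 2) * b - a / 2"
  proof -
    have "(S x + a - 2 * a) * p + (a + b - 2 * a) / 2 = k * a"
      using g(3)[of "{x, v}"] ricci_row[OF G2, of "{x, v}" g] arcs(2) vxy
      by (simp add: E2 S2 S_v deg2 p_def a_def[symmetric] vxy[symmetric])
    then show "X = (k + p + 1 / 2) * a - b / 2" by (simp add: X_def field_simps)
    have "(S y + b - 2 * b) * q + (a + b - 2 * b) / 2 = k * b"
      using g(3)[of "{v, y}"] ricci_row[OF G2, of "{v, y}" g] arcs(2) vxy
      by (simp add: E2 S2 S_v deg2 q_def b_def[symmetric] vxy[symmetric])
    then show "Y = (k + q + 1 / 2) * b - a / 2" by (simp add: Y_def field_simps)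
  qed
  have cone: "b \<le> (2 * (k + p) + 1) * a" "a \<le> (2 * (k + q) + 1) * b"
  proof -
    have "X \<ge> 0" "Y \<ge> 0"
      using S_nonneg p(1) q(1) by (simp_all add: X_def Y_def)
    then show "b \<le> (2 * (k + p) + 1) * a" "a \<le> (2 * (k + q) + 1) * b"
      unfolding X Y by (simp_all add: field_simps)
  qed

  \<comment> \<open>The numerator is \<open>X + Y\<close>, where the halves cancel, so
    \<open>t\<close> maximizes
    \<open>(2 * t - a) * X + (2 * t - b) * Y - (k + p + q) * t\<^sup>2\<close>, the gain computed in
    \<open>diff\<close> below.\<close>
  define t where "t = ((k + p) * a + (k + q) * b) / (k + p + q)"
  define f where "f = g({x, y} := t)"
  have Sf: "incident_sum T f z = S z + (if z \<in> {x, y} then t else 0)" for z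
    unfolding S_def f_def incident_sum_upd[OF G xy] by simp
  have fxy: "f {x, y} = t"
    by (simp add: f_def)
  have row_xy: "(\<Sum>e'\<in>uedges T. ricci T {x, y} e' * f e') = X + Y - (p + q) * t"
    using ricci_row[OF G xy, of f] arcs(2)
    by (simp add: Sf fxy X_def Y_def p_def q_def diff_divide_distrib add_divide_distrib distrib_right)
  \<comment> \<open>Away from \<open>xy\<close> the vertex sums of \<open>f\<close> and
    \<open>g\<close> differ only at \<open>x\<close>, where \<open>t\<close> replaces
    \<open>a\<close>, and at \<open>y\<close>, where \<open>t\<close> replaces
    \<open>b\<close>.\<close>
  have row: "(\<Sum>e'\<in>uedges T. ricci T e e' * f e') =
      k * f e + (if x \<in> e then p * (t - a) else 0) + (if y \<in> e then q * (t - b) else 0)"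
    if e: "e \<in> uedges T" "e \<noteq> {x, y}" for e
  proof -
    have ve: "z \<noteq> v" if "z \<in> e" for z using v_notin[OF e(1)] that by auto
    have fe: "f e = g e" using e(2) by (simp add: f_def)
    have "(\<Sum>e'\<in>uedges T. ricci T e e' * f e') = (\<Sum>z\<in>e. (incident_sum T f z - 2 * f e) / real (vdeg T z))"
      by (rule ricci_row[OF G e(1)])
    also have "\<dots> = (\<Sum>z\<in>e. (incident_sum T2 g z - 2 * g e) / real (vdeg T2 z)
        + (if z = x then p * (t - a) else 0) + (if z = y then q * (t - b) else 0))"
    proof (rule sum.cong)
      fix z assume "z \<in> e"
      then show "(incident_sum T f z - 2 * f e) / real (vdeg T z) =
        (incident_sum T2 g z - 2 * g e) / real (vdeg T2 z)
        + (if z = x then p * (t - a) else 0) + (if z = y then q * (t - b) else 0)"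
        using ve[of z] arcs(2)
        by (auto simp: Sf S2 fe deg2 p_def q_def simp flip: add_divide_distrib diff_divide_distrib)
    qed simp
    also have "\<dots> = (\<Sum>z\<in>e. (incident_sum T2 g z - 2 * g e) / real (vdeg T2 z))
        + (if x \<in> e then p * (t - a) else 0) + (if y \<in> e then q * (t - b) else 0)"
      using finite_uedge[OF G e(1)] by (simp add: sum.distrib)
    also have "(\<Sum>z\<in>e. (incident_sum T2 g z - 2 * g e) / real (vdeg T2 z)) = k * f e"
      using ricci_row[OF G2, of e g] g(3)[of e] e fe by (simp add: E2)
    finally show ?thesis .
  qed

  show False
  proof (cases "a = 0 \<and> b = 0")
    case True
    \<comment> \<open>All error terms in \<open>row\<close> and \<open>row_xy\<close> vanish, so
      \<open>f\<close> is a nonnegative eigenvector on \<open>T\<close> that is 0 on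
      \<open>xy\<close>.\<close>
    then have "t = 0" "X = 0" "Y = 0"
      using X Y by (simp_all add: t_def)
    then have eig: "(\<Sum>e'\<in>uedges T. ricci T e e' * f e') = k * f e" if "e \<in> uedges T" for e
      using row[OF that] row_xy True by (cases "e = {x, y}") (simp_all add: fxy)
    have "f e = 0" if "e \<in> uedges T" for e
      using nonneg_ricci_eigenvector_vanishes[OF G conn _ eig xy _ that] g(1) \<open>t = 0\<close>
      by (simp add: f_def)
    then have "g e = 0" if "e \<in> uedges T - {{x, y}}" for e
      using that by (metis DiffE f_def fun_upd_other singletonI)
    then have "g e = 0" if "e \<in> uedges T2" for e
      using that True unfolding E2 a_def b_def by blast
    then show False using g(2) by blast
  next
    case False
    have "quad_form (uedges T) (ricci T) f - k * sq_norm (uedges T) f =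
        (\<Sum>e\<in>uedges T. f e * ((\<Sum>e'\<in>uedges T. ricci T e e' * f e') - k * f e))"
      unfolding quad_form_def sq_norm_def sum_distrib_left[of k]
      by (simp add: right_diff_distrib power2_eq_square sum_subtractf mult_ac)
    also have "\<dots> = t * (X + Y - (p + q) * t - k * t)
        + (\<Sum>e\<in>uedges T - {{x, y}}. f e * ((\<Sum>e'\<in>uedges T. ricci T e e' * f e') - k * f e))"
      by (subst sum.remove[OF finite_uedges[OF G] xy]) (simp add: row_xy fxy)
    also have "(\<Sum>e\<in>uedges T - {{x, y}}. f e * ((\<Sum>e'\<in>uedges T. ricci T e e' * f e') - k * f e))
        = (\<Sum>e\<in>uedges T - {{x, y}}. p * (t - a) * (if x \<in> e then g e else 0)
            + q * (t - b) * (if y \<in> e then g e else 0))"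
    proof (rule sum.cong)
      fix e assume "e \<in> uedges T - {{x, y}}"
      then have e: "e \<in> uedges T" "e \<noteq> {x, y}" and fe: "f e = g e"
        by (auto simp: f_def)
      show "f e * ((\<Sum>e'\<in>uedges T. ricci T e e' * f e') - k * f e)
          = p * (t - a) * (if x \<in> e then g e else 0) + q * (t - b) * (if y \<in> e then g e else 0)"
        unfolding row[OF e] fe by (simp add: algebra_simps)
    qed simp
    \<comment> \<open>The row errors, weighted by \<open>g\<close>, add up over the remaining edges
      at \<open>x\<close> and at \<open>y\<close>.\<close>
    also have "\<dots> = p * (t - a) * S x + q * (t - b) * S y"
    proof -
      have "(\<Sum>e\<in>uedges T - {{x, y}}. if z \<in> e then g e else 0) = S z" for z
        unfolding S_def incident_sum_def using finite_uedges[OF G]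
        by (intro sum.mono_neutral_cong_left) auto
      then show ?thesis by (simp add: sum.distrib flip: sum_distrib_left)
    qed
    also have "t * (X + Y - (p + q) * t - k * t) + (p * (t - a) * S x + q * (t - b) * S y)
        = (2 * t - a) * X + (2 * t - b) * Y - (k + p + q) * t\<^sup>2"
      by (simp add: X_def Y_def algebra_simps power2_eq_square)
    finally have diff: "quad_form (uedges T) (ricci T) f - k * sq_norm (uedges T) f =
        (2 * t - a) * X + (2 * t - b) * Y - (k + p + q) * t\<^sup>2" .
    define s where "s = k + p + q"
    have "s > 0" using p q \<open>k > 0\<close> by (simp add: s_def)
    have st: "s * t = (k + p) * a + (k + q) * b"
      using \<open>s > 0\<close> by (simp add: t_def s_def)
    \<comment> \<open>Multiplying by \<open>s > 0\<close> leaves only the product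
      \<open>s * t\<close>, which \<open>st\<close> expresses without division.\<close>
    have "s * ((2 * t - a) * X + (2 * t - b) * Y - s * t\<^sup>2)
        = 2 * (s * t) * (X + Y) - s * (a * X + b * Y) - (s * t)\<^sup>2"
      by (simp add: algebra_simps power2_eq_square)
    also have "\<dots> = 2 * (k + p) * (k + q) * a * b - q * (k + p) * a\<^sup>2 - p * (k + q) * b\<^sup>2
        - s * (a - b)\<^sup>2 / 2"
      unfolding st unfolding X Y s_def by (simp add: field_simps power2_eq_square)
    also have "\<dots> > 0"
      unfolding s_def using False by (intro gluing_form_pos p q \<open>k > 0\<close> cone) auto
    finally have "(2 * t - a) * X + (2 * t - b) * Y - s * t\<^sup>2 > 0"
      using \<open>s > 0\<close> by (simp add: zero_less_mult_iff)
    then have "k * sq_norm (uedges T) f < quad_form (uedges T) (ricci T) f"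
      using diff by (simp add: s_def)
    \<comment> \<open>The Rayleigh bound on \<open>T\<close> and \<open>k_ge\<close> lead the chain
      back to its strictly smaller first term.\<close>
    also have "\<dots> \<le> ricci_lambda_max T * sq_norm (uedges T) f"
      unfolding ricci_lambda_max_def using xy
      by (intro quad_form_le_lambda_max finite_uedges[OF G] ricci_sym) auto
    also have "\<dots> \<le> k * sq_norm (uedges T) f"
      using k_ge by (intro mult_right_mono) (auto simp: sq_norm_def sum_nonneg)
    finally show False by simp
  qed
qed

end
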